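(* Suppose $\gamma_n>0$ for all $n$, $E\varepsilon_0^2=1$, $E\varepsilon_0^4<\infty$, and, as $n\to\infty$, $$n\alpha_n\to\infty,\quad n|\gamma_n|\to\infty,\quad \alpha_n n^{1/2}\log\log n\to0,\quad \frac{\gamma_n}{\alpha_n}=O(1).$$ Let $N\ge1$ be a fixed integer and $0<t_1<t_2<\cdots<t_N\le1$. Then the random variables $$(\omega^{-1}\gamma)^{1/2}e^{-[nt_m]\gamma/2}\,y_{[nt_m]},\qquad 1\le m\le N,$$ are asymptotically independent, each with asymptotic distribution equal to the distribution of $\varepsilon_0$; that is, as $n\to\infty$ they converge jointly in distribution to a vector of $N$ independent copies of $\varepsilon_0$.
   Context: Let $\varepsilon_0,\varepsilon_1,\varepsilon_2,\dots$ be independent identically distributed real random variables (not necessarily of mean zero) such that the distribution of $\varepsilon_0^2$ is nondegenerate. Let $\omega>0$ be a constant. For each $n\ge1$ let $\alpha=\alpha_n\ge0$ and $\beta=\beta_n\ge0$ be real numbers with $\alpha_n\to0$ and $\beta_n\to1$ as $n\to\infty$. Given an initial value $\sigma_0$ (a fixed real number not depending on $n$) and $y_0=\sigma_0\varepsilon_0$, define for each $n$ the sequences $\sigma_k\ge 0$ and $y_k$, $1\le k\le n$ (which depend on $n$ through $\alpha_n,\beta_n$), by $y_k=\sigma_k\varepsilon_k$ and $\sigma_k^2=\omega+\alpha y_{k-1}^2+\beta\sigma_{k-1}^2$. Put $\gamma=\gamma_n=\alpha_n+\beta_n-1$. $[x]$ denotes the integer part of $x$. *)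

theory Defs
  imports "HOL-Probability.Probability"
begin

text \<open>
  Pathwise GARCH(1,1) recursion driven by the realised innovations \<open>e\<close>. Taking the square root
  is what selects the solution with nonnegative volatility after time 0; the initial value
  \<open>s0\<close> is an arbitrary real number.
\<close>

fun garch_sigma :: "real \<Rightarrow> real \<Rightarrow> real \<Rightarrow> real \<Rightarrow> (nat \<Rightarrow> real) \<Rightarrow> nat \<Rightarrow> real" where
  "garch_sigma \<omega> a b s0 e 0 = s0"
| "garch_sigma \<omega> a b s0 e (Suc k) =
     sqrt (\<omega> + a * (garch_sigma \<omega> a b s0 e k * e k)\<^sup>2 + b * (garch_sigma \<omega> a b s0 e k)\<^sup>2)"

definition garch_y :: "real \<Rightarrow> real \<Rightarrow> real \<Rightarrow> real \<Rightarrow> (nat \<Rightarrow> real) \<Rightarrow> nat \<Rightarrow> real" where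
  "garch_y \<omega> a b s0 e k = garch_sigma \<omega> a b s0 e k * e k"

lemma garch_sigma_Suc_nonneg:
  assumes "0 \<le> \<omega>" "0 \<le> a" "0 \<le> b"
  shows "0 \<le> garch_sigma \<omega> a b s0 e (Suc k)"
  using assms by simp

lemma garch_sigma_Suc_squared:
  assumes "0 \<le> \<omega>" "0 \<le> a" "0 \<le> b"
  shows "(garch_sigma \<omega> a b s0 e (Suc k))\<^sup>2 =
    \<omega> + a * (garch_y \<omega> a b s0 e k)\<^sup>2 + b * (garch_sigma \<omega> a b s0 e k)\<^sup>2"
  using assms by (simp add: garch_y_def)

text \<open>
  Weak convergence of Borel measures, tested on bounded continuous real functions. The library's
  \<open>weak_conv_m\<close> covers only measures on the real line.
\<close>

definition weak_conv_borel :: "(nat \<Rightarrow> 'b::topological_space measure) \<Rightarrow> 'b measure \<Rightarrow> bool" where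
  "weak_conv_borel \<mu> \<nu> \<longleftrightarrow>
    (\<forall>f :: 'b \<Rightarrow> real. continuous_on UNIV f \<longrightarrow> bounded (range f) \<longrightarrow>
       (\<lambda>n. integral\<^sup>L (\<mu> n) f) \<longlonglongrightarrow> integral\<^sup>L \<nu> f)"

text \<open>The law on \<open>real ^ 'N\<close> of a vector with independent components, each of law \<open>\<mu>\<close>.\<close>

definition iid_vec_law :: "real measure \<Rightarrow> (real ^ 'N) measure" where
  "iid_vec_law \<mu> = distr (Pi\<^sub>M (UNIV :: 'N set) (\<lambda>_. \<mu>)) borel (\<lambda>x. \<chi> m. x m)"

end

theory Submission
  imports Defs "HOL-Real_Asymp.Real_Asymp"
begin

text \<open>
  Let \<open>m\<^sub>k = E \<sigma>\<^sub>k\<^sup>2\<close>. As \<open>\<gamma> > 0\<close>, the one-step recursion yields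
  \<open>E \<sigma>\<^sub>k\<^sup>4 \<le> (1 + \<alpha>\<^sup>2 Var \<epsilon>\<^sub>0\<^sup>2)\<^sup>k m\<^sub>k\<^sup>2\<close>. Since \<open>n \<alpha>\<^sup>2 \<rightarrow> 0\<close>, \<open>n \<gamma>\<^sup>2 \<rightarrow> 0\<close> and \<open>k \<gamma> \<rightarrow> \<infinity>\<close>
  for \<open>k = [n t]\<close>, it follows that \<open>(\<gamma> / \<omega>) exp (- k \<gamma>) \<sigma>\<^sub>k\<^sup>2 \<rightarrow> 1\<close> in mean square. The volatility
  \<open>\<sigma>\<^sub>k\<close> is independent of \<open>\<epsilon>\<^sub>k\<close>, so the normalised \<open>y\<^sub>k\<close> differs from \<open>\<epsilon>\<^sub>k\<close> by an error
  vanishing in mean square. The indices \<open>[n t\<^sub>m]\<close> are eventually distinct, and then the vector of the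
  \<open>\<epsilon>\<^sub>k\<close> has exactly the limiting law; Slutsky's argument concludes.
\<close>

section \<open>Random vectors and weak convergence\<close>

lemma measurable_vec_lambda [measurable (raw)]:
  fixes f :: "'i::finite \<Rightarrow> 'a \<Rightarrow> real"
  assumes "\<And>i. f i \<in> borel_measurable M"
  shows "(\<lambda>x. \<chi> i. f i x) \<in> borel_measurable M"
  unfolding borel_measurable_euclidean_space[of _ M, where 'c = "real ^ 'i"]
  using assms by (auto simp: Basis_vec_def inner_axis)

text \<open>A bounded continuous \<open>f\<close> is uniformly continuous only on compact sets, so
  the sample space is split three ways: \<open>X n\<close> and \<open>Y n\<close> far apart,
  \<open>Y n\<close> outside a large ball, and the rest. The first event is rare by closeness, the
  second by tightness of the single law \<open>\<nu>\<close>, and on the rest uniform continuity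
  controls the difference.\<close>

lemma (in prob_space) weak_conv_borel_Slutsky:
  fixes X Y :: "nat \<Rightarrow> 'a \<Rightarrow> 'b::euclidean_space"
  assumes X [measurable]: "\<And>n. X n \<in> borel_measurable M"
    and Y [measurable]: "\<And>n. Y n \<in> borel_measurable M"
    and law: "\<forall>\<^sub>F n in sequentially. distr M borel (Y n) = \<nu>"
    and close: "\<And>\<delta>. 0 < \<delta> \<Longrightarrow> (\<lambda>n. prob {x \<in> space M. \<delta> \<le> dist (X n x) (Y n x)}) \<longlonglongrightarrow> 0"
  shows "weak_conv_borel (\<lambda>n. distr M borel (X n)) \<nu>"
  unfolding weak_conv_borel_def
proof (intro allI impI)
  fix f :: "'b \<Rightarrow> real"
  assume cont: "continuous_on UNIV f" and bdd: "bounded (range f)"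
  have f [measurable]: "f \<in> borel_measurable borel"
    using cont by (rule borel_measurable_continuous_onI)
  obtain B where B: "0 < B" "\<And>z. \<bar>f z\<bar> \<le> B"
    using bdd by (auto simp: bounded_pos)
  \<comment> \<open>One index with law \<open>\<nu>\<close> suffices to see that
    \<open>\<nu>\<close> is a Borel probability measure.\<close>
  obtain n0 where n0: "distr M borel (Y n0) = \<nu>"
    using law by (auto simp: eventually_sequentially)
  interpret nu: prob_space \<nu>
    unfolding n0[symmetric] by (rule prob_space_distr) simp
  have sets_nu [measurable_cong, simp]: "sets \<nu> = sets borel"
    using n0 by (metis sets_distr)
  have space_nu [simp]: "space \<nu> = UNIV"
    using sets_eq_imp_space_eq[OF sets_nu] by simp
  have tail: "(\<lambda>k. nu.prob (- cball 0 (real k))) \<longlonglongrightarrow> 0"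
  proof -
    have "(\<lambda>k. nu.prob (- cball 0 (real k))) \<longlonglongrightarrow> nu.prob (\<Inter>k. - cball 0 (real k))"
      by (rule nu.finite_Lim_measure_decseq) (auto simp: decseq_def)
    moreover have "(\<Inter>k. - cball (0::'b) (real k)) = {}"
    proof -
      have "x \<notin> (\<Inter>k. - cball 0 (real k))" for x :: 'b
        using real_arch_simple[of "norm x"] by auto
      then show ?thesis by blast
    qed
    ultimately show ?thesis by simp
  qed
  show "(\<lambda>n. integral\<^sup>L (distr M borel (X n)) f) \<longlonglongrightarrow> integral\<^sup>L \<nu> f"
  proof (rule tendstoI)
    fix r :: real assume "0 < r"
    \<comment> \<open>Each exceptional event costs at most \<open>2 * B\<close> times its
      probability, hence less than \<open>r / 3\<close>.\<close>
    obtain k where k: "nu.prob (- cball 0 (real k)) < r / (6 * B)"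
      using order_tendstoD(2)[OF tail, of "r / (6 * B)"] \<open>0 < r\<close> B(1)
      by (auto simp: eventually_sequentially)
    \<comment> \<open>The radius exceeds \<open>k\<close> by 1 because \<open>X n\<close> may lie
      outside the ball around \<open>Y n\<close>'s range by up to \<open>\<delta>\<close>, which is
      at most 1.\<close>
    have "uniformly_continuous_on (cball 0 (real k + 1)) f"
      using cont by (intro compact_uniformly_continuous) (auto intro: continuous_on_subset)
    moreover have "0 < r / 3" using \<open>0 < r\<close> by simp
    ultimately obtain d where d: "0 < d"
      "\<And>y z. y \<in> cball 0 (real k + 1) \<Longrightarrow> z \<in> cball 0 (real k + 1) \<Longrightarrow> dist z y < d \<Longrightarrow> dist (f z) (f y) < r / 3"
      by (rule uniformly_continuous_onE) blast
    define \<delta> where "\<delta> = min d 1"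
    have \<delta>: "0 < \<delta>" "\<delta> \<le> 1" "\<delta> \<le> d" using d(1) by (auto simp: \<delta>_def)
    define P where "P n = {x \<in> space M. \<delta> \<le> dist (X n x) (Y n x)}" for n
    define Q where "Q n = {x \<in> space M. real k < norm (Y n x)}" for n
    have [measurable]: "P n \<in> events" "Q n \<in> events" for n
      unfolding P_def Q_def by measurable
    have ev: "\<forall>\<^sub>F n in sequentially. prob (P n) < r / (6 * B)"
      using order_tendstoD(2)[OF close[OF \<delta>(1)], of "r / (6 * B)"] \<open>0 < r\<close> B(1)
      unfolding P_def by simp
    show "\<forall>\<^sub>F n in sequentially. dist (integral\<^sup>L (distr M borel (X n)) f) (integral\<^sup>L \<nu> f) < r"
      using ev law
    proof eventually_elim
      fix n assume Pn: "prob (P n) < r / (6 * B)" and lawn: "distr M borel (Y n) = \<nu>"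
      have Qn: "prob (Q n) < r / (6 * B)"
      proof -
        have "nu.prob (- cball 0 (real k)) = prob (Q n)"
          unfolding lawn[symmetric] by (subst measure_distr) (auto simp: Q_def not_le intro!: arg_cong[where f=prob])
        with k show ?thesis by simp
      qed
      have iX: "integrable M (\<lambda>x. f (X n x))" and iY: "integrable M (\<lambda>x. f (Y n x))"
        using B(2) by (auto intro!: integrable_const_bound[where B=B])
      have pw: "\<bar>f (X n x) - f (Y n x)\<bar> \<le> r / 3 + 2 * B * indicator (P n) x + 2 * B * indicator (Q n) x"
        if x: "x \<in> space M" for x
      proof (cases "x \<in> P n \<or> x \<in> Q n")
        case True
        have "\<bar>f (X n x) - f (Y n x)\<bar> \<le> 2 * B"
          using B(2)[of "X n x"] B(2)[of "Y n x"] by linarith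
        with True \<open>0 < r\<close> B(1) show ?thesis by (auto simp: indicator_def)
      next
        case False
        then have *: "dist (X n x) (Y n x) < \<delta>" "norm (Y n x) \<le> real k"
          using x by (auto simp: P_def Q_def)
        have "norm (X n x) \<le> norm (Y n x) + dist (X n x) (Y n x)"
          by (simp add: dist_norm norm_triangle_sub)
        with * \<delta> have "dist (f (X n x)) (f (Y n x)) < r / 3"
          by (intro d(2)) auto
        with False show ?thesis by (simp add: dist_real_def)
      qed
      have "\<bar>integral\<^sup>L M (\<lambda>x. f (X n x)) - integral\<^sup>L M (\<lambda>x. f (Y n x))\<bar>
          = \<bar>integral\<^sup>L M (\<lambda>x. f (X n x) - f (Y n x))\<bar>"
        using iX iY by simp
      also have "\<dots> \<le> integral\<^sup>L M (\<lambda>x. \<bar>f (X n x) - f (Y n x)\<bar>)"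
        by (rule integral_abs_bound)
      also have "\<dots> \<le> integral\<^sup>L M (\<lambda>x. r / 3 + 2 * B * indicator (P n) x + 2 * B * indicator (Q n) x)"
        using iX iY pw by (intro integral_mono) (auto simp: integrable_indicator_iff emeasure_eq_measure)
      also have "\<dots> = r / 3 + 2 * B * prob (P n) + 2 * B * prob (Q n)"
        by (simp add: prob_space Int_absorb1 emeasure_eq_measure)
      also have "\<dots> < r / 3 + r / 3 + r / 3"
      proof -
        have "2 * B * prob (P n) < r / 3" "2 * B * prob (Q n) < r / 3"
          using Pn Qn B(1) by (auto simp: field_simps)
        then show ?thesis by linarith
      qed
      finally show "dist (integral\<^sup>L (distr M borel (X n)) f) (integral\<^sup>L \<nu> f) < r"
        unfolding lawn[symmetric] by (simp add: integral_distr dist_real_def)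
    qed
  qed
qed

text \<open>Injectivity of \<open>\<kappa>\<close> makes the singleton blocks
  \<open>{\<kappa> m}\<close> disjoint, so the selected components are independent; a repeated index
  would put the same variable in two components.\<close>

lemma (in prob_space) distr_iid_vec:
  fixes e :: "'k \<Rightarrow> 'a \<Rightarrow> real" and \<kappa> :: "'n::finite \<Rightarrow> 'k"
  assumes indep: "indep_vars (\<lambda>_. borel) e UNIV"
    and ident: "\<And>k. distr M borel (e k) = \<mu>"
    and inj: "inj \<kappa>"
  shows "distr M borel (\<lambda>x. \<chi> m. e (\<kappa> m) x) = iid_vec_law \<mu>"
proof -
  have measurable_e: "e k \<in> borel_measurable M" for k
    using indep by (simp add: indep_vars_def)
  have "indep_vars (\<lambda>m. PiM {\<kappa> m} (\<lambda>_. borel)) (\<lambda>m x. restrict (\<lambda>i. e i x) {\<kappa> m}) UNIV"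
    using inj by (intro indep_vars_restrict[OF indep]) (auto simp: disjoint_family_on_def inj_def)
  then have "indep_vars (\<lambda>_. borel) (\<lambda>m x. (restrict (\<lambda>i. e i x) {\<kappa> m}) (\<kappa> m)) UNIV"
    by (rule indep_vars_compose2) (auto intro: measurable_component_singleton)
  then have "indep_vars (\<lambda>_. borel) (\<lambda>m x. e (\<kappa> m) x) UNIV"
    by simp
  then have *: "distr M (\<Pi>\<^sub>M m\<in>UNIV. borel) (\<lambda>x. \<lambda>m\<in>UNIV. e (\<kappa> m) x) = (\<Pi>\<^sub>M m\<in>UNIV. \<mu>)"
    by (subst (asm) indep_vars_iff_distr_eq_PiM) (auto simp: ident measurable_e)
  have "iid_vec_law \<mu> = distr (distr M (\<Pi>\<^sub>M m\<in>(UNIV::'n set). borel) (\<lambda>x. \<lambda>m\<in>UNIV. e (\<kappa> m) x)) borel (\<lambda>x. \<chi> m. x m)"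
    unfolding iid_vec_law_def * ..
  also have "\<dots> = distr M borel ((\<lambda>x. \<chi> m. x m) \<circ> (\<lambda>x. \<lambda>m\<in>UNIV. e (\<kappa> m) x))"
    by (rule distr_distr) (rule measurable_vec_lambda measurable_component_singleton measurable_restrict UNIV_I measurable_e)+
  also have "\<dots> = distr M borel (\<lambda>x. \<chi> m. e (\<kappa> m) x)"
    by (simp add: comp_def restrict_UNIV)
  finally show ?thesis by simp
qed

section \<open>Deterministic asymptotics\<close>

text \<open>For nonzero \<open>g\<close>, this is the closed form of the solution of m(k+1) =
  \<omega> + (1 + g) m(k) with m(0) the square of \<open>s0\<close>.\<close>

definition garch_mean :: "real \<Rightarrow> real \<Rightarrow> real \<Rightarrow> nat \<Rightarrow> real" where
  "garch_mean \<omega> g s0 k = s0\<^sup>2 * (1 + g) ^ k + \<omega> * ((1 + g) ^ k - 1) / g"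

text \<open>The sequence \<open>u\<close> stands for the mean of the normalised squared volatility,
  and the expression bounds the mean square of that variable minus 1. Both \<open>u\<close> and the
  power factor tend to 1, so the limit is 1 - 2 + 1.\<close>

lemma garch_error_bound_tendsto_0:
  fixes \<omega> c s0 :: real and a g :: "nat \<Rightarrow> real" and k :: "nat \<Rightarrow> nat"
  assumes \<omega>: "0 < \<omega>" and c: "0 \<le> c"
    and g_pos: "\<forall>\<^sub>F n in sequentially. 0 < g n" and g_0: "g \<longlonglongrightarrow> 0"
    and ka2: "(\<lambda>n. real (k n) * (a n)\<^sup>2) \<longlonglongrightarrow> 0"
    and kg2: "(\<lambda>n. real (k n) * (g n)\<^sup>2) \<longlonglongrightarrow> 0"
    and kg: "filterlim (\<lambda>n. real (k n) * g n) at_top sequentially"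
  defines "u \<equiv> \<lambda>n. g n / \<omega> * exp (- (real (k n) * g n)) * garch_mean \<omega> (g n) s0 (k n)"
  shows "(\<lambda>n. (1 + (a n)\<^sup>2 * c) ^ k n * (u n)\<^sup>2 - 2 * u n + 1) \<longlonglongrightarrow> 0"
proof -
  define L where "L n = (1 + g n) ^ k n * exp (- (real (k n) * g n))" for n
  have L_lim: "L \<longlonglongrightarrow> 1"
  proof -
    have "\<forall>\<^sub>F n in sequentially. g n < 1"
      using g_0 by (rule order_tendstoD) simp
    with g_pos have ev: "\<forall>\<^sub>F n in sequentially. 0 < g n \<and> g n < 1"
      by eventually_elim simp
    \<comment> \<open>This is the logarithm of \<open>L n\<close>; the Taylor error of ln is
      quadratic in \<open>g n\<close>, which is where \<open>kg2\<close> enters.\<close>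
    have "(\<lambda>n. real (k n) * (ln (1 + g n) - g n)) \<longlonglongrightarrow> 0"
    proof (rule Lim_null_comparison[OF _ kg2])
      show "\<forall>\<^sub>F n in sequentially. norm (real (k n) * (ln (1 + g n) - g n)) \<le> real (k n) * (g n)\<^sup>2"
        using ev
      proof eventually_elim
        case (elim n)
        then have "\<bar>ln (1 + g n) - g n\<bar> \<le> (g n)\<^sup>2"
          by (intro abs_ln_one_plus_x_minus_x_bound_nonneg) auto
        then show ?case by (simp add: abs_mult mult_left_mono)
      qed
    qed
    then have "(\<lambda>n. exp (real (k n) * (ln (1 + g n) - g n))) \<longlonglongrightarrow> exp 0"
      by (intro tendsto_exp)
    moreover have "\<forall>\<^sub>F n in sequentially. exp (real (k n) * (ln (1 + g n) - g n)) = L n"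
      using ev by eventually_elim
        (simp add: L_def right_diff_distrib exp_diff exp_minus divide_inverse exp_of_nat_mult)
    ultimately show ?thesis by (simp add: tendsto_cong)
  qed
  have "u \<longlonglongrightarrow> 1"
  proof -
    have "(\<lambda>n. exp (- (real (k n) * g n))) \<longlonglongrightarrow> 0"
      using kg by (intro filterlim_compose[OF exp_at_bot]) (simp add: filterlim_uminus_at_top)
    \<comment> \<open>Three contributions to \<open>u\<close>: the initial value vanishes with
      \<open>g\<close>, the growing part of the mean gives \<open>L\<close>, and the constant
      subtracted in the mean is damped by the exponential.\<close>
    then have "(\<lambda>n. g n / \<omega> * s0\<^sup>2 * L n + L n - exp (- (real (k n) * g n))) \<longlonglongrightarrow> 0 / \<omega> * s0\<^sup>2 * 1 + 1 - 0"
      using L_lim g_0 \<omega> by (intro tendsto_intros) auto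
    moreover have "\<forall>\<^sub>F n in sequentially. g n / \<omega> * s0\<^sup>2 * L n + L n - exp (- (real (k n) * g n)) = u n"
      using g_pos by eventually_elim (use \<omega> in \<open>simp add: u_def L_def garch_mean_def field_simps\<close>)
    ultimately show ?thesis by (simp add: tendsto_cong)
  qed
  moreover have "(\<lambda>n. (1 + (a n)\<^sup>2 * c) ^ k n) \<longlonglongrightarrow> 1"
  proof (rule tendsto_sandwich[of "\<lambda>_. 1"])
    show "\<forall>\<^sub>F n in sequentially. 1 \<le> (1 + (a n)\<^sup>2 * c) ^ k n"
      using c by (intro always_eventually allI one_le_power) simp
    have "(1 + (a n)\<^sup>2 * c) ^ k n \<le> exp (real (k n) * (a n)\<^sup>2 * c)" for n
    proof -
      have "(1 + (a n)\<^sup>2 * c) ^ k n \<le> exp ((a n)\<^sup>2 * c) ^ k n"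
        using c by (intro power_mono exp_ge_add_one_self) auto
      then show ?thesis by (simp add: exp_of_nat_mult mult.assoc)
    qed
    then show "\<forall>\<^sub>F n in sequentially. (1 + (a n)\<^sup>2 * c) ^ k n \<le> exp (real (k n) * (a n)\<^sup>2 * c)"
      by simp
    have "(\<lambda>n. exp (real (k n) * (a n)\<^sup>2 * c)) \<longlonglongrightarrow> exp (0 * c)"
      using ka2 by (intro tendsto_intros)
    then show "(\<lambda>n. exp (real (k n) * (a n)\<^sup>2 * c)) \<longlonglongrightarrow> 1" by simp
  qed simp
  ultimately have "(\<lambda>n. (1 + (a n)\<^sup>2 * c) ^ k n * (u n)\<^sup>2 - 2 * u n + 1) \<longlonglongrightarrow> 1 * 1\<^sup>2 - 2 * 1 + 1"
    by (intro tendsto_intros)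
  then show ?thesis by simp
qed

section \<open>Moments of the volatility and mean-square error\<close>

locale unit_innovations = prob_space +
  fixes e :: "nat \<Rightarrow> 'a \<Rightarrow> real"
  assumes indep: "indep_vars (\<lambda>_. borel) e UNIV"
    and ident: "\<And>k. distr M borel (e k) = distr M borel (e 0)"
    and second_moment: "expectation (\<lambda>x. (e 0 x)\<^sup>2) = 1"
    and integrable_fourth0: "integrable M (\<lambda>x. (e 0 x) ^ 4)"
begin

lemma measurable_e [measurable]: "e k \<in> borel_measurable M"
  using indep by (simp add: indep_vars_def)

lemma
  fixes h :: "real \<Rightarrow> real"
  assumes [measurable]: "h \<in> borel_measurable borel"
  shows integrable_e_iff: "integrable M (\<lambda>x. h (e k x)) \<longleftrightarrow> integrable M (\<lambda>x. h (e 0 x))"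
    and expectation_e: "expectation (\<lambda>x. h (e k x)) = expectation (\<lambda>x. h (e 0 x))"
proof -
  show "integrable M (\<lambda>x. h (e k x)) \<longleftrightarrow> integrable M (\<lambda>x. h (e 0 x))"
    using arg_cong[OF ident[of k], of "\<lambda>N. integrable N h"] by (simp add: integrable_distr_eq)
  show "expectation (\<lambda>x. h (e k x)) = expectation (\<lambda>x. h (e 0 x))"
    using arg_cong[OF ident[of k], of "\<lambda>N. integral\<^sup>L N h"] by (simp add: integral_distr)
qed

lemma integrable_second: "integrable M (\<lambda>x. (e k x)\<^sup>2)"
proof -
  have "integrable M (\<lambda>x. (e 0 x)\<^sup>2)"
    \<comment> \<open>A non-integrable function has integral 0 by convention, so the value 1 already
      forces integrability.\<close>
    using second_moment not_integrable_integral_eq by fastforce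
  then show ?thesis using integrable_e_iff[of "\<lambda>z. z\<^sup>2" k] by simp
qed

lemma integrable_fourth: "integrable M (\<lambda>x. (e k x) ^ 4)"
  using integrable_fourth0 integrable_e_iff[of "\<lambda>z. z ^ 4" k] by simp

lemma expectation_second: "expectation (\<lambda>x. (e k x)\<^sup>2) = 1"
  using second_moment expectation_e[of "\<lambda>z. z\<^sup>2" k] by simp

text \<open>The variance of the squared innovation, whose mean is 1; equivalently the fourth moment
  minus 1.\<close>

definition kurt :: real where
  "kurt = expectation (\<lambda>x. ((e 0 x)\<^sup>2 - 1)\<^sup>2)"

text \<open>The recursion reaches step \<open>k\<close> by reading only innovations with index below
  \<open>k\<close>. This adaptedness lets the volatility be treated as a function on a product over
  past coordinates.\<close>

lemma garch_sigma_measurable_past: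
  "k \<le> n \<Longrightarrow> (\<lambda>u. garch_sigma \<omega> a b s0 u k) \<in> borel_measurable (PiM {..<n} (\<lambda>_. borel))"
proof (induction k)
  case (Suc k)
  then have [measurable]: "(\<lambda>u. garch_sigma \<omega> a b s0 u k) \<in> borel_measurable (PiM {..<n} (\<lambda>_. borel))"
    "(\<lambda>u. u k) \<in> borel_measurable (PiM {..<n} (\<lambda>_. borel :: real measure))"
    by (auto intro!: measurable_component_singleton)
  show ?case by simp
qed simp

lemma garch_sigma_restrict:
  "k \<le> n \<Longrightarrow> garch_sigma \<omega> a b s0 (restrict u {..<n}) k = garch_sigma \<omega> a b s0 u k"
  by (induction k) auto

text \<open>The volatility at time \<open>k\<close> is a function of the block
  \<open>{..<k}\<close>, which is disjoint from \<open>{k}\<close>; independence of the two blocks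
  passes to functions of them.\<close>

lemma indep_garch_sigma:
  assumes [measurable]: "g \<in> borel_measurable borel" "h \<in> borel_measurable borel"
  shows "indep_var borel (\<lambda>x. g (garch_sigma \<omega> a b s0 (\<lambda>j. e j x) k)) borel (\<lambda>x. h (e k x))"
proof -
  have *: "indep_var (PiM {..<k} (\<lambda>_. borel)) (\<lambda>x. restrict (\<lambda>j. e j x) {..<k})
      (PiM {k} (\<lambda>_. borel)) (\<lambda>x. restrict (\<lambda>j. e j x) {k})"
    by (rule indep_var_restrict[OF indep]) auto
  have g: "(\<lambda>u. g (garch_sigma \<omega> a b s0 u k)) \<in> borel_measurable (PiM {..<k} (\<lambda>_. borel))"
    by (rule measurable_compose[OF garch_sigma_measurable_past assms(1)]) simp
  have h: "(\<lambda>u. h (u k)) \<in> borel_measurable (PiM {k} (\<lambda>_. borel))"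
    by (rule measurable_compose[OF _ assms(2)]) (rule measurable_component_singleton, simp)
  have "indep_var borel ((\<lambda>u. g (garch_sigma \<omega> a b s0 u k)) \<circ> (\<lambda>x. restrict (\<lambda>j. e j x) {..<k}))
      borel ((\<lambda>u. h (u k)) \<circ> (\<lambda>x. restrict (\<lambda>j. e j x) {k}))"
    by (rule indep_var_compose[OF * g h])
  then show ?thesis by (simp add: comp_def garch_sigma_restrict)
qed

lemma
  assumes [measurable]: "g \<in> borel_measurable borel" "h \<in> borel_measurable borel"
    and "integrable M (\<lambda>x. g (garch_sigma \<omega> a b s0 (\<lambda>j. e j x) k) :: real)"
    and "integrable M (\<lambda>x. h (e k x) :: real)"
  shows integrable_sigma_times_e:
      "integrable M (\<lambda>x. g (garch_sigma \<omega> a b s0 (\<lambda>j. e j x) k) * h (e k x))" (is ?int)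
    and expectation_sigma_times_e:
      "expectation (\<lambda>x. g (garch_sigma \<omega> a b s0 (\<lambda>j. e j x) k) * h (e k x)) =
       expectation (\<lambda>x. g (garch_sigma \<omega> a b s0 (\<lambda>j. e j x) k)) * expectation (\<lambda>x. h (e k x))" (is ?exp)
proof -
  note indep = indep_garch_sigma[OF assms(1,2)]
  show ?int by (rule indep_var_integrable[OF indep assms(3,4)])
  show ?exp by (rule indep_var_lebesgue_integral[OF indep assms(3,4)])
qed

lemma measurable_garch_sigma [measurable]:
  "(\<lambda>x. garch_sigma \<omega> a b s0 (\<lambda>j. e j x) k) \<in> borel_measurable M"
  by (induction k) simp_all

lemma expectation_e_fourth: "expectation (\<lambda>x. ((e k x)\<^sup>2)\<^sup>2) = 1 + kurt"
proof -
  have "kurt = expectation (\<lambda>x. (e 0 x) ^ 4 - 2 * (e 0 x)\<^sup>2 + 1)"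
    unfolding kurt_def by (intro Bochner_Integration.integral_cong) (auto simp: power2_eq_square power4_eq_xxxx algebra_simps)
  also have "\<dots> = expectation (\<lambda>x. (e 0 x) ^ 4) - 1"
    using integrable_fourth integrable_second second_moment by (simp add: prob_space)
  finally have "expectation (\<lambda>x. (e 0 x) ^ 4) = 1 + kurt" by simp
  then show ?thesis
    using expectation_e[of "\<lambda>z. z ^ 4" k] by simp
qed

lemma kurt_nonneg: "0 \<le> kurt"
  unfolding kurt_def by simp

text \<open>
  Since \<open>1 + g \<ge> 1\<close>, the ratio of the second moment to the squared mean grows at each step at most
  by the factor \<open>1 + a\<^sup>2 * kurt\<close>.
\<close>

lemma garch_moments:
  fixes \<omega> a b g s0 :: real
  assumes \<omega>: "0 \<le> \<omega>" and a: "0 \<le> a" and b: "0 \<le> b" and g: "0 < g" "g = a + b - 1"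
  defines "S \<equiv> \<lambda>k x. garch_sigma \<omega> a b s0 (\<lambda>j. e j x) k"
    and "m \<equiv> garch_mean \<omega> g s0"
  shows "integrable M (\<lambda>x. (S k x)\<^sup>2) \<and> integrable M (\<lambda>x. ((S k x)\<^sup>2)\<^sup>2) \<and>
    expectation (\<lambda>x. (S k x)\<^sup>2) = m k \<and>
    expectation (\<lambda>x. ((S k x)\<^sup>2)\<^sup>2) \<le> (1 + a\<^sup>2 * kurt) ^ k * (m k)\<^sup>2"
proof (induction k)
  case 0
  then show ?case by (simp add: S_def m_def garch_mean_def prob_space)
next
  case (Suc k)
  define X where "X x = (S k x)\<^sup>2" for x
  define E where "E x = (e k x)\<^sup>2" for x
  have step: "(S (Suc k) x)\<^sup>2 = \<omega> + a * (X x * E x) + b * X x" for x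
    unfolding S_def X_def E_def garch_sigma_Suc_squared[OF \<omega> a b] garch_y_def
    by (simp add: power_mult_distrib)
  \<comment> \<open>The square is expanded into monomials in \<open>X\<close> and \<open>E\<close>,
    each of which has a factorising expectation by independence.\<close>
  have step2: "((S (Suc k) x)\<^sup>2)\<^sup>2 = \<omega>\<^sup>2 + 2 * \<omega> * a * (X x * E x) + 2 * \<omega> * b * X x
      + a\<^sup>2 * ((X x)\<^sup>2 * (E x)\<^sup>2) + 2 * a * b * ((X x)\<^sup>2 * E x) + b\<^sup>2 * (X x)\<^sup>2" for x
    unfolding step by (simp add: power2_eq_square algebra_simps)
  have iX: "integrable M X" "integrable M (\<lambda>x. (X x)\<^sup>2)"
    and eX: "expectation X = m k" "expectation (\<lambda>x. (X x)\<^sup>2) \<le> (1 + a\<^sup>2 * kurt) ^ k * (m k)\<^sup>2"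
    using Suc by (auto simp: X_def[abs_def])
  have iE: "integrable M E" "integrable M (\<lambda>x. (E x)\<^sup>2)"
    and eE: "expectation E = 1" "expectation (\<lambda>x. (E x)\<^sup>2) = 1 + kurt"
    using integrable_second[of k] integrable_fourth[of k] expectation_second[of k] expectation_e_fourth[of k]
    by (auto simp: E_def[abs_def])
  have p1: "integrable M (\<lambda>x. X x * E x)" "expectation (\<lambda>x. X x * E x) = m k"
    using integrable_sigma_times_e[of "\<lambda>z. z\<^sup>2" "\<lambda>z. z\<^sup>2" \<omega> a b s0 k]
      expectation_sigma_times_e[of "\<lambda>z. z\<^sup>2" "\<lambda>z. z\<^sup>2" \<omega> a b s0 k] iX iE eX eE
    by (simp_all add: X_def[abs_def] E_def[abs_def] S_def)
  have p2: "integrable M (\<lambda>x. (X x)\<^sup>2 * E x)"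
      "expectation (\<lambda>x. (X x)\<^sup>2 * E x) = expectation (\<lambda>x. (X x)\<^sup>2)"
    using integrable_sigma_times_e[of "\<lambda>z. (z\<^sup>2)\<^sup>2" "\<lambda>z. z\<^sup>2" \<omega> a b s0 k]
      expectation_sigma_times_e[of "\<lambda>z. (z\<^sup>2)\<^sup>2" "\<lambda>z. z\<^sup>2" \<omega> a b s0 k] iX iE eX eE
    by (simp_all add: X_def[abs_def] E_def[abs_def] S_def)
  have p3: "integrable M (\<lambda>x. (X x)\<^sup>2 * (E x)\<^sup>2)"
      "expectation (\<lambda>x. (X x)\<^sup>2 * (E x)\<^sup>2) = expectation (\<lambda>x. (X x)\<^sup>2) * (1 + kurt)"
    using integrable_sigma_times_e[of "\<lambda>z. (z\<^sup>2)\<^sup>2" "\<lambda>z. (z\<^sup>2)\<^sup>2" \<omega> a b s0 k]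
      expectation_sigma_times_e[of "\<lambda>z. (z\<^sup>2)\<^sup>2" "\<lambda>z. (z\<^sup>2)\<^sup>2" \<omega> a b s0 k] iX iE eX eE
    by (simp_all add: X_def[abs_def] E_def[abs_def] S_def)
  have m_Suc: "m (Suc k) = \<omega> + (1 + g) * m k"
    unfolding m_def using g(1) by (simp add: garch_mean_def field_simps)
  have q: "1 \<le> 1 + g" "a + b = 1 + g" using g by auto
  have m_nonneg: "0 \<le> m k"
    unfolding eX(1)[symmetric] by (simp add: X_def)
  have r: "1 \<le> 1 + a\<^sup>2 * kurt" using kurt_nonneg by simp
  have e1: "expectation (\<lambda>x. (S (Suc k) x)\<^sup>2) = m (Suc k)"
    unfolding step m_Suc q(2)[symmetric] using p1 iX eX by (simp add: prob_space algebra_simps)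
  have "expectation (\<lambda>x. ((S (Suc k) x)\<^sup>2)\<^sup>2) =
      \<omega>\<^sup>2 + 2 * \<omega> * a * m k + 2 * \<omega> * b * m k + a\<^sup>2 * (expectation (\<lambda>x. (X x)\<^sup>2) * (1 + kurt))
      + 2 * a * b * expectation (\<lambda>x. (X x)\<^sup>2) + b\<^sup>2 * expectation (\<lambda>x. (X x)\<^sup>2)"
    unfolding step2 using p1 p2 p3 iX eX(1) by (simp add: prob_space)
  \<comment> \<open>The coefficients of the second moment of \<open>X\<close> combine to (a + b)^2
    plus the excess a^2 \<open>kurt\<close>, and a + b = 1 + g.\<close>
  also have "\<dots> = \<omega>\<^sup>2 + 2 * \<omega> * (1 + g) * m k + ((1 + g)\<^sup>2 + a\<^sup>2 * kurt) * expectation (\<lambda>x. (X x)\<^sup>2)"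
    unfolding q(2)[symmetric] by (simp add: power2_eq_square algebra_simps)
  also have "\<dots> \<le> \<omega>\<^sup>2 + 2 * \<omega> * (1 + g) * m k
      + ((1 + g)\<^sup>2 * (1 + a\<^sup>2 * kurt)) * ((1 + a\<^sup>2 * kurt) ^ k * (m k)\<^sup>2)"
  proof (intro add_left_mono mult_mono eX(2))
    have "1 * (a\<^sup>2 * kurt) \<le> (1 + g)\<^sup>2 * (a\<^sup>2 * kurt)"
      using q(1) kurt_nonneg by (intro mult_right_mono) (auto simp: one_le_power)
    then show "(1 + g)\<^sup>2 + a\<^sup>2 * kurt \<le> (1 + g)\<^sup>2 * (1 + a\<^sup>2 * kurt)"
      by (simp add: algebra_simps)
  qed (use kurt_nonneg in auto)
  \<comment> \<open>Inflating the remaining nonnegative terms by the same power, which is at least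
    1, completes the square of \<open>m (Suc k)\<close>.\<close>
  also have "\<dots> \<le> (1 + a\<^sup>2 * kurt) ^ Suc k * (\<omega>\<^sup>2 + 2 * \<omega> * (1 + g) * m k)
      + ((1 + g)\<^sup>2 * (1 + a\<^sup>2 * kurt)) * ((1 + a\<^sup>2 * kurt) ^ k * (m k)\<^sup>2)"
  proof (rule add_right_mono)
    have "0 \<le> \<omega>\<^sup>2 + 2 * \<omega> * (1 + g) * m k" using \<omega> g(1) m_nonneg by simp
    moreover have "1 \<le> (1 + a\<^sup>2 * kurt) ^ Suc k" using r by (rule one_le_power)
    ultimately have "1 * (\<omega>\<^sup>2 + 2 * \<omega> * (1 + g) * m k) \<le> (1 + a\<^sup>2 * kurt) ^ Suc k * (\<omega>\<^sup>2 + 2 * \<omega> * (1 + g) * m k)"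
      by (intro mult_right_mono)
    then show "\<omega>\<^sup>2 + 2 * \<omega> * (1 + g) * m k \<le> (1 + a\<^sup>2 * kurt) ^ Suc k * (\<omega>\<^sup>2 + 2 * \<omega> * (1 + g) * m k)"
      by simp
  qed
  also have "\<dots> = (1 + a\<^sup>2 * kurt) ^ Suc k * (m (Suc k))\<^sup>2"
  proof -
    have *: "P * U + (Q\<^sup>2 * R) * (T * V\<^sup>2) = P * (U + Q\<^sup>2 * V\<^sup>2)" if "P = R * T" for P Q R T U V :: real
      using that by (simp add: algebra_simps)
    have "\<omega>\<^sup>2 + 2 * \<omega> * (1 + g) * m k + (1 + g)\<^sup>2 * (m k)\<^sup>2 = (m (Suc k))\<^sup>2"
      unfolding m_Suc by (simp add: power2_eq_square algebra_simps)
    then show ?thesis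
      by (subst *) simp_all
  qed
  finally have e2: "expectation (\<lambda>x. ((S (Suc k) x)\<^sup>2)\<^sup>2) \<le> (1 + a\<^sup>2 * kurt) ^ Suc k * (m (Suc k))\<^sup>2" .
  have "integrable M (\<lambda>x. (S (Suc k) x)\<^sup>2)" "integrable M (\<lambda>x. ((S (Suc k) x)\<^sup>2)\<^sup>2)"
    subgoal unfolding step using p1 iX by simp
    subgoal unfolding step2 using p1 p2 p3 iX by simp
    done
  with e1 e2 show ?case by blast
qed

text \<open>The error is (sqrt A \<sigma> - 1) times the current innovation. These factors are
  independent and the innovation has second moment 1, so only the volatility factor matters. The
  square root is removed by |s - 1| \<le> |s^2 - 1| for s \<ge> 0.\<close>

lemma garch_y_close:
  fixes \<omega> a b g s0 A :: real
  assumes \<omega>: "0 \<le> \<omega>" and a: "0 \<le> a" and b: "0 \<le> b" and g: "0 < g" "g = a + b - 1"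
    and A: "0 \<le> A" and k: "0 < k"
  shows "integrable M (\<lambda>x. (sqrt A * garch_y \<omega> a b s0 (\<lambda>j. e j x) k - e k x)\<^sup>2)"
    and "expectation (\<lambda>x. (sqrt A * garch_y \<omega> a b s0 (\<lambda>j. e j x) k - e k x)\<^sup>2)
      \<le> (1 + a\<^sup>2 * kurt) ^ k * (A * garch_mean \<omega> g s0 k)\<^sup>2 - 2 * (A * garch_mean \<omega> g s0 k) + 1"
proof -
  define S where "S x = garch_sigma \<omega> a b s0 (\<lambda>j. e j x) k" for x
  note mom = garch_moments[OF \<omega> a b g, of s0 k, folded S_def]
  have i2: "integrable M (\<lambda>x. (A * (S x)\<^sup>2 - 1)\<^sup>2)"
    and e2: "expectation (\<lambda>x. (A * (S x)\<^sup>2 - 1)\<^sup>2)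
      \<le> (1 + a\<^sup>2 * kurt) ^ k * (A * garch_mean \<omega> g s0 k)\<^sup>2 - 2 * (A * garch_mean \<omega> g s0 k) + 1"
  proof -
    have *: "(A * (S x)\<^sup>2 - 1)\<^sup>2 = A\<^sup>2 * ((S x)\<^sup>2)\<^sup>2 - 2 * A * (S x)\<^sup>2 + 1" for x
      by (simp add: power2_eq_square algebra_simps)
    show "integrable M (\<lambda>x. (A * (S x)\<^sup>2 - 1)\<^sup>2)"
      unfolding * using mom by auto
    \<comment> \<open>The mean enters with a negative sign and is therefore used as an exact value;
      only the fourth moment is estimated.\<close>
    have "expectation (\<lambda>x. (A * (S x)\<^sup>2 - 1)\<^sup>2) =
        A\<^sup>2 * expectation (\<lambda>x. ((S x)\<^sup>2)\<^sup>2) - 2 * A * garch_mean \<omega> g s0 k + 1"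
      unfolding * using mom by (simp add: prob_space)
    also have "\<dots> \<le> A\<^sup>2 * ((1 + a\<^sup>2 * kurt) ^ k * (garch_mean \<omega> g s0 k)\<^sup>2) - 2 * A * garch_mean \<omega> g s0 k + 1"
      using mom by (intro add_right_mono diff_right_mono mult_left_mono) auto
    finally show "expectation (\<lambda>x. (A * (S x)\<^sup>2 - 1)\<^sup>2)
      \<le> (1 + a\<^sup>2 * kurt) ^ k * (A * garch_mean \<omega> g s0 k)\<^sup>2 - 2 * (A * garch_mean \<omega> g s0 k) + 1"
      by (simp add: power_mult_distrib mult_ac)
  qed
  have [measurable]: "S \<in> borel_measurable M"
    unfolding S_def by measurable
  have le: "(sqrt A * S x - 1)\<^sup>2 \<le> (A * (S x)\<^sup>2 - 1)\<^sup>2" for x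
  proof -
    have S: "0 \<le> sqrt A * S x"
    proof -
      \<comment> \<open>Positivity of \<open>k\<close> matters here: the initial value
        \<open>s0\<close> may be negative, whereas later volatilities are square roots.\<close>
      obtain j where j: "k = Suc j" using k gr0_implies_Suc by blast
      have "0 \<le> S x" unfolding S_def j by (rule garch_sigma_Suc_nonneg[OF \<omega> a b])
      then show ?thesis using A by simp
    qed
    have "A * (S x)\<^sup>2 - 1 = (sqrt A * S x - 1) * (sqrt A * S x + 1)"
      using A by (simp add: algebra_simps power2_eq_square)
    moreover have "1 * \<bar>sqrt A * S x - 1\<bar> \<le> \<bar>sqrt A * S x + 1\<bar> * \<bar>sqrt A * S x - 1\<bar>"
      using S by (intro mult_right_mono) auto
    ultimately show ?thesis
      by (intro abs_le_square_iff[THEN iffD1]) (simp add: abs_mult mult.commute)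
  qed
  have i1: "integrable M (\<lambda>x. (sqrt A * S x - 1)\<^sup>2)"
    by (rule Bochner_Integration.integrable_bound[OF i2]) (use le in auto)
  have eq: "(sqrt A * garch_y \<omega> a b s0 (\<lambda>j. e j x) k - e k x)\<^sup>2 = (sqrt A * S x - 1)\<^sup>2 * (e k x)\<^sup>2" for x
    by (simp add: garch_y_def S_def power2_eq_square algebra_simps)
  show "integrable M (\<lambda>x. (sqrt A * garch_y \<omega> a b s0 (\<lambda>j. e j x) k - e k x)\<^sup>2)"
    unfolding eq using i1 integrable_second[of k] unfolding S_def
    by (intro integrable_sigma_times_e[of "\<lambda>z. (sqrt A * z - 1)\<^sup>2" "\<lambda>z. z\<^sup>2"]) auto
  have "expectation (\<lambda>x. (sqrt A * garch_y \<omega> a b s0 (\<lambda>j. e j x) k - e k x)\<^sup>2)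
      = expectation (\<lambda>x. (sqrt A * S x - 1)\<^sup>2) * expectation (\<lambda>x. (e k x)\<^sup>2)"
    unfolding eq using i1 integrable_second[of k] unfolding S_def
    by (intro expectation_sigma_times_e[of "\<lambda>z. (sqrt A * z - 1)\<^sup>2" "\<lambda>z. z\<^sup>2"]) auto
  also have "\<dots> \<le> expectation (\<lambda>x. (A * (S x)\<^sup>2 - 1)\<^sup>2)"
    unfolding expectation_second using i1 i2 le by (simp add: integral_mono)
  also note e2
  finally show "expectation (\<lambda>x. (sqrt A * garch_y \<omega> a b s0 (\<lambda>j. e j x) k - e k x)\<^sup>2)
      \<le> (1 + a\<^sup>2 * kurt) ^ k * (A * garch_mean \<omega> g s0 k)\<^sup>2 - 2 * (A * garch_mean \<omega> g s0 k) + 1" .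
qed

end

section \<open>Growth and separation of the time indices\<close>

lemma eventually_nat_floor_mult_neq:
  fixes s t :: real
  assumes "0 < s" "s < t"
  shows "\<forall>\<^sub>F n in sequentially. nat \<lfloor>real n * s\<rfloor> \<noteq> nat \<lfloor>real n * t\<rfloor>"
proof -
  have "filterlim (\<lambda>n. real n * (t - s)) at_top sequentially"
    using assms by real_asymp
  then have "\<forall>\<^sub>F n in sequentially. 1 \<le> real n * (t - s)"
    by (simp add: filterlim_at_top)
  then show ?thesis
  proof eventually_elim
    case (elim n)
    then have "\<lfloor>real n * s\<rfloor> < \<lfloor>real n * t\<rfloor>"
      by (simp add: algebra_simps) linarith
    moreover have "0 \<le> \<lfloor>real n * s\<rfloor>" using assms by simp
    ultimately show ?case by linarith
  qed
qed

text \<open>Taking the integer part loses at most 1, and this loss multiplied by \<open>g n\<close>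
  vanishes in the limit.\<close>

lemma filterlim_nat_floor_mult_at_top:
  fixes t :: real
  assumes t: "0 < t" and g_0: "g \<longlonglongrightarrow> 0" and g_pos: "\<forall>\<^sub>F n in sequentially. 0 < g n"
    and ng: "filterlim (\<lambda>n. real n * g n) at_top sequentially"
  shows "filterlim (\<lambda>n. real (nat \<lfloor>real n * t\<rfloor>) * g n) at_top sequentially"
proof (rule filterlim_at_top_mono)
  have "filterlim (\<lambda>n. - g n + t * (real n * g n)) at_top sequentially"
    using tendsto_minus[OF g_0]
    by (rule filterlim_tendsto_add_at_top) (rule filterlim_tendsto_pos_mult_at_top[OF tendsto_const t ng])
  then show "filterlim (\<lambda>n. (real n * t - 1) * g n) at_top sequentially"
    by (simp add: algebra_simps)
  show "\<forall>\<^sub>F n in sequentially. (real n * t - 1) * g n \<le> real (nat \<lfloor>real n * t\<rfloor>) * g n"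
    using g_pos
  proof eventually_elim
    case (elim n)
    have "real n * t - 1 \<le> real (nat \<lfloor>real n * t\<rfloor>)" by linarith
    then show ?case using elim by (intro mult_right_mono) auto
  qed
qed

section \<open>Joint convergence in distribution\<close>

theorem theorem2p6:
  fixes M :: "'a measure"
    and \<epsilon> :: "nat \<Rightarrow> 'a \<Rightarrow> real"
    and \<omega> \<sigma>\<^sub>0 :: real
    and \<alpha> \<beta> \<gamma> :: "nat \<Rightarrow> real"
    and t :: "'N::{finite, linorder} \<Rightarrow> real"
  assumes "prob_space M"
    and "prob_space.indep_vars M (\<lambda>_. borel) \<epsilon> UNIV"
    and "\<And>k. distr M borel (\<epsilon> k) = distr M borel (\<epsilon> 0)"
    and "\<not> (\<exists>c. AE x in M. (\<epsilon> 0 x)\<^sup>2 = c)"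
    and "0 < \<omega>"
    and "\<And>n. 1 \<le> n \<Longrightarrow> 0 \<le> \<alpha> n"
    and "\<And>n. 1 \<le> n \<Longrightarrow> 0 \<le> \<beta> n"
    and "\<alpha> \<longlonglongrightarrow> 0"
    and "\<beta> \<longlonglongrightarrow> 1"
    and "\<And>n. \<gamma> n = \<alpha> n + \<beta> n - 1"
    and "\<And>n. 1 \<le> n \<Longrightarrow> 0 < \<gamma> n"
    and "integrable M (\<lambda>x. (\<epsilon> 0 x)\<^sup>2)"
    and "prob_space.expectation M (\<lambda>x. (\<epsilon> 0 x)\<^sup>2) = 1"
    and "integrable M (\<lambda>x. (\<epsilon> 0 x) ^ 4)"
    and "filterlim (\<lambda>n. real n * \<alpha> n) at_top sequentially"
    and "filterlim (\<lambda>n. real n * \<bar>\<gamma> n\<bar>) at_top sequentially"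
    and "(\<lambda>n. \<alpha> n * sqrt (real n) * ln (ln (real n))) \<longlonglongrightarrow> 0"
    and "(\<lambda>n. \<gamma> n / \<alpha> n) \<in> O(\<lambda>_. 1)"
    and "strict_mono t"
    and "\<And>m. 0 < t m"
    and "\<And>m. t m \<le> 1"
  shows "weak_conv_borel
    (\<lambda>n. distr M borel (\<lambda>x. \<chi> m.
       sqrt (\<gamma> n / \<omega>) * exp (- (real (nat \<lfloor>real n * t m\<rfloor>) * \<gamma> n / 2)) *
       garch_y \<omega> (\<alpha> n) (\<beta> n) \<sigma>\<^sub>0 (\<lambda>k. \<epsilon> k x) (nat \<lfloor>real n * t m\<rfloor>)))
    (iid_vec_law (distr M borel (\<epsilon> 0)) :: (real ^ ('N::{finite, linorder})) measure)"
proof -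
  interpret prob_space M by fact
  interpret unit_innovations M \<epsilon>
    by unfold_locales fact+
  define \<kappa> where "\<kappa> n m = nat \<lfloor>real n * t m\<rfloor>" for n m
  \<comment> \<open>The square of the normalising factor, so that it multiplies the squared
    volatility.\<close>
  define A where "A n m = \<gamma> n / \<omega> * exp (- (real (\<kappa> n m) * \<gamma> n))" for n m
  define X where "X n x = (\<chi> m. sqrt (\<gamma> n / \<omega>) * exp (- (real (\<kappa> n m) * \<gamma> n / 2)) *
      garch_y \<omega> (\<alpha> n) (\<beta> n) \<sigma>\<^sub>0 (\<lambda>k. \<epsilon> k x) (\<kappa> n m))" for n x
  define Y where "Y n x = (\<chi> m. \<epsilon> (\<kappa> n m) x)" for n x
  define D where "D n m x = sqrt (A n m) * garch_y \<omega> (\<alpha> n) (\<beta> n) \<sigma>\<^sub>0 (\<lambda>k. \<epsilon> k x) (\<kappa> n m) - \<epsilon> (\<kappa> n m) x" for n m x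
  define bnd where "bnd n m = (1 + (\<alpha> n)\<^sup>2 * kurt) ^ \<kappa> n m * (A n m * garch_mean \<omega> (\<gamma> n) \<sigma>\<^sub>0 (\<kappa> n m))\<^sup>2
      - 2 * (A n m * garch_mean \<omega> (\<gamma> n) \<sigma>\<^sub>0 (\<kappa> n m)) + 1" for n m

  have ge1: "\<forall>\<^sub>F n in sequentially. 1 \<le> n" by (rule eventually_ge_at_top)
  have g_pos: "\<forall>\<^sub>F n in sequentially. 0 < \<gamma> n"
    using ge1 by eventually_elim (rule assms(11))
  have g_0: "\<gamma> \<longlonglongrightarrow> 0"
  proof -
    have "(\<lambda>n. \<alpha> n + \<beta> n - 1) \<longlonglongrightarrow> 0 + 1 - 1"
      using assms(8,9) by (intro tendsto_intros)
    moreover have "\<gamma> = (\<lambda>n. \<alpha> n + \<beta> n - 1)" by (rule ext) (rule assms(10))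
    ultimately show ?thesis by simp
  qed
  have ng: "filterlim (\<lambda>n. real n * \<gamma> n) at_top sequentially"
  proof -
    have "\<forall>\<^sub>F n in sequentially. real n * \<bar>\<gamma> n\<bar> = real n * \<gamma> n"
      using g_pos by eventually_elim simp
    from filterlim_cong[OF refl refl this] assms(16) show ?thesis by (rule iffD1)
  qed
  have na2: "(\<lambda>n. real n * (\<alpha> n)\<^sup>2) \<longlonglongrightarrow> 0"
  proof -
    \<comment> \<open>Once the iterated logarithm is at least 1, dropping it only decreases the
      absolute value, so \<alpha> times the square root of n also tends to 0.\<close>
    have "\<forall>\<^sub>F n in sequentially. 1 \<le> ln (ln (real n))" by real_asymp
    then have "\<forall>\<^sub>F n in sequentially. norm (\<alpha> n * sqrt (real n)) \<le> \<bar>\<alpha> n * sqrt (real n) * ln (ln (real n))\<bar>"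
    proof eventually_elim
      case (elim n)
      then have "\<bar>\<alpha> n * sqrt (real n)\<bar> * 1 \<le> \<bar>\<alpha> n * sqrt (real n)\<bar> * \<bar>ln (ln (real n))\<bar>"
        by (intro mult_left_mono) auto
      then show ?case by (simp add: abs_mult)
    qed
    then have "(\<lambda>n. \<alpha> n * sqrt (real n)) \<longlonglongrightarrow> 0"
      by (rule Lim_null_comparison) (rule tendsto_rabs_zero[OF assms(17)])
    then have "(\<lambda>n. (\<alpha> n * sqrt (real n))\<^sup>2) \<longlonglongrightarrow> 0\<^sup>2"
      by (rule tendsto_power)
    then show ?thesis by (simp add: power_mult_distrib mult.commute)
  qed
  obtain C where C: "0 < C" "\<forall>\<^sub>F n in sequentially. \<bar>\<gamma> n / \<alpha> n\<bar> \<le> C"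
    using assms(18) by (auto elim!: landau_o.bigE)
  have ng2: "(\<lambda>n. real n * (\<gamma> n)\<^sup>2) \<longlonglongrightarrow> 0"
  proof (rule Lim_null_comparison)
    have "(\<lambda>n. C\<^sup>2 * (real n * (\<alpha> n)\<^sup>2)) \<longlonglongrightarrow> C\<^sup>2 * 0"
      using na2 by (intro tendsto_intros)
    then show "(\<lambda>n. C\<^sup>2 * (real n * (\<alpha> n)\<^sup>2)) \<longlonglongrightarrow> 0" by simp
    \<comment> \<open>This excludes \<open>\<alpha> n = 0\<close>, where the quotient is 0 by
      convention and its bound would say nothing about \<open>\<gamma> n\<close>.\<close>
    have "\<forall>\<^sub>F n in sequentially. 0 < real n * \<alpha> n"
      using assms(15) by (simp add: filterlim_at_top_dense)
    then show "\<forall>\<^sub>F n in sequentially. norm (real n * (\<gamma> n)\<^sup>2) \<le> C\<^sup>2 * (real n * (\<alpha> n)\<^sup>2)"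
      using C(2)
    proof eventually_elim
      case (elim n)
      then have "\<alpha> n \<noteq> 0" by auto
      with elim have "\<bar>\<gamma> n\<bar> \<le> C * \<bar>\<alpha> n\<bar>"
        by (simp add: divide_le_eq)
      then have "(\<gamma> n)\<^sup>2 \<le> (C * \<alpha> n)\<^sup>2"
        using C(1) by (simp add: abs_le_square_iff[symmetric] abs_mult)
      then have "real n * (\<gamma> n)\<^sup>2 \<le> real n * (C * \<alpha> n)\<^sup>2"
        by (rule mult_left_mono) simp
      then show ?case by (simp add: power_mult_distrib mult_ac)
    qed
  qed
  have k_le: "real (\<kappa> n m) \<le> real n" for n m
  proof -
    have "real n * t m \<le> real n * 1" by (rule mult_left_mono[OF assms(21)]) simp
    then show ?thesis unfolding \<kappa>_def by linarith
  qed
  have k_sq: "(\<lambda>n. real (\<kappa> n m) * (z n)\<^sup>2) \<longlonglongrightarrow> 0"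
    if "(\<lambda>n. real n * (z n)\<^sup>2) \<longlonglongrightarrow> 0" for z m
    by (rule Lim_null_comparison[OF _ that]) (auto intro!: always_eventually mult_right_mono k_le)
  have kg: "filterlim (\<lambda>n. real (\<kappa> n m) * \<gamma> n) at_top sequentially" for m
    unfolding \<kappa>_def by (rule filterlim_nat_floor_mult_at_top[OF assms(20) g_0 g_pos ng])
  have bnd_0: "(\<lambda>n. bnd n m) \<longlonglongrightarrow> 0" for m
    unfolding bnd_def A_def
    by (rule garch_error_bound_tendsto_0[OF assms(5) kurt_nonneg g_pos g_0 k_sq[OF na2] k_sq[OF ng2] kg])
  have k_pos: "\<forall>\<^sub>F n in sequentially. 0 < \<kappa> n m" for m
  proof -
    have "\<forall>\<^sub>F n in sequentially. 0 < real (\<kappa> n m) * \<gamma> n"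
      using kg[of m] by (simp add: filterlim_at_top_dense)
    then show ?thesis by eventually_elim (auto intro: gr0I)
  qed
  have inj: "\<forall>\<^sub>F n in sequentially. inj (\<kappa> n)"
  proof -
    have "\<forall>\<^sub>F n in sequentially. m \<noteq> m' \<longrightarrow> \<kappa> n m \<noteq> \<kappa> n m'" for m m'
    proof (cases m m' rule: linorder_cases)
      case less
      then have "t m < t m'" by (rule strict_monoD[OF assms(19)])
      from eventually_nat_floor_mult_neq[OF assms(20) this] show ?thesis
        unfolding \<kappa>_def by eventually_elim simp
    next
      case greater
      then have "t m' < t m" by (rule strict_monoD[OF assms(19)])
      from eventually_nat_floor_mult_neq[OF assms(20) this] show ?thesis
        unfolding \<kappa>_def by eventually_elim simp
    qed simp
    \<comment> \<open>There are finitely many pairs, so one threshold for \<open>n\<close> serves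
      them all.\<close>
    then have "\<forall>\<^sub>F n in sequentially. \<forall>m m'. m \<noteq> m' \<longrightarrow> \<kappa> n m \<noteq> \<kappa> n m'"
      by (intro eventually_all_finite)
    then show ?thesis by eventually_elim (auto simp: inj_def)
  qed

  have measurable_y [measurable]: "(\<lambda>x. garch_y \<omega> a b s0 (\<lambda>k. \<epsilon> k x) j) \<in> borel_measurable M" for a b s0 j
    unfolding garch_y_def by measurable
  have X_meas: "X n \<in> borel_measurable M" for n
    unfolding X_def[abs_def] by (intro measurable_vec_lambda) measurable
  have Y_meas: "Y n \<in> borel_measurable M" for n
    unfolding Y_def[abs_def] by (intro measurable_vec_lambda) measurable
  have law: "\<forall>\<^sub>F n in sequentially. distr M borel (Y n) = iid_vec_law (distr M borel (\<epsilon> 0))"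
    using inj unfolding Y_def[abs_def]
    by eventually_elim (rule distr_iid_vec[OF assms(2,3)])
  have dist_sq: "(dist (X n x) (Y n x))\<^sup>2 = (\<Sum>m\<in>UNIV. (D n m x)\<^sup>2)" for n x
  proof -
    have "sqrt (A n m) = sqrt (\<gamma> n / \<omega>) * exp (- (real (\<kappa> n m) * \<gamma> n / 2))" for m
    proof -
      have "exp (- (real (\<kappa> n m) * \<gamma> n)) = (exp (- (real (\<kappa> n m) * \<gamma> n / 2)))\<^sup>2"
        by (simp add: exp_double[symmetric])
      then show ?thesis unfolding A_def by (simp only: real_sqrt_mult) simp
    qed
    then show ?thesis
      by (simp add: dist_vec_def L2_set_def sum_nonneg X_def Y_def D_def dist_real_def)
  qed
  have close: "(\<lambda>n. prob {x \<in> space M. \<delta> \<le> dist (X n x) (Y n x)}) \<longlonglongrightarrow> 0" if "0 < \<delta>" for \<delta>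
  proof (rule Lim_null_comparison)
    have "(\<lambda>n. (\<Sum>m\<in>UNIV. bnd n m) / \<delta>\<^sup>2) \<longlonglongrightarrow> (\<Sum>m\<in>(UNIV::'N set). 0) / \<delta>\<^sup>2"
      using that by (intro tendsto_intros bnd_0) auto
    then show "(\<lambda>n. (\<Sum>m\<in>UNIV. bnd n m) / \<delta>\<^sup>2) \<longlonglongrightarrow> 0" by simp
    have "\<forall>\<^sub>F n in sequentially. \<forall>m. 0 < \<kappa> n m"
      using k_pos by (rule eventually_all_finite)
    then show "\<forall>\<^sub>F n in sequentially. norm (prob {x \<in> space M. \<delta> \<le> dist (X n x) (Y n x)}) \<le> (\<Sum>m\<in>UNIV. bnd n m) / \<delta>\<^sup>2"
      using ge1
    proof eventually_elim
      case (elim n)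
      have A: "0 \<le> A n m" for m
        unfolding A_def using assms(5) assms(11)[OF elim(2)] by simp
      have k: "0 < \<kappa> n m" for m using elim(1) by blast
      note y_close = garch_y_close[OF less_imp_le[OF assms(5)] assms(6)[OF elim(2)] assms(7)[OF elim(2)]
          assms(11)[OF elim(2)] assms(10) A k]
      have D: "integrable M (\<lambda>x. (D n m x)\<^sup>2)" "expectation (\<lambda>x. (D n m x)\<^sup>2) \<le> bnd n m" for m
        unfolding D_def bnd_def by (rule y_close)+
      have int: "integrable M (\<lambda>x. (dist (X n x) (Y n x))\<^sup>2)"
        unfolding dist_sq by (intro Bochner_Integration.integrable_sum D)
      \<comment> \<open>Chebyshev's inequality for the Euclidean distance, whose square is the sum
        of the componentwise squared errors.\<close>
      have "prob {x \<in> space M. \<delta> \<le> dist (X n x) (Y n x)} \<le> expectation (\<lambda>x. (dist (X n x) (Y n x))\<^sup>2) / \<delta>\<^sup>2"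
        using second_moment_method[OF _ int that] X_meas Y_meas by simp
      also have "expectation (\<lambda>x. (dist (X n x) (Y n x))\<^sup>2) = (\<Sum>m\<in>UNIV. expectation (\<lambda>x. (D n m x)\<^sup>2))"
        unfolding dist_sq by (intro Bochner_Integration.integral_sum D)
      also have "\<dots> / \<delta>\<^sup>2 \<le> (\<Sum>m\<in>UNIV. bnd n m) / \<delta>\<^sup>2"
        by (intro divide_right_mono sum_mono D) simp
      finally show ?case by simp
    qed
  qed
  have "weak_conv_borel (\<lambda>n. distr M borel (X n)) (iid_vec_law (distr M borel (\<epsilon> 0)))"
    by (rule weak_conv_borel_Slutsky[OF X_meas Y_meas law close])
  then show ?thesis
    unfolding X_def[abs_def] \<kappa>_def .
qed

end
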